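(* Let $\mathbb{G}$ be a finite reflexive digraph. Suppose there exist a finite reflexive digraph $\mathbb{K}$ and vertices $x_1,\dots,x_k,u$ of $\mathbb{K}$ such that: (1) for every $a \in G$ there exists a map $f_a:\{x_1,\dots,x_k\}\to G$ such that $(\mathbb{K},f_a,u)$ pp-defines $G \setminus \{a\}$; (2) for every map $f:\{x_1,\dots,x_k\}\to G$, the set pp-defined by $(\mathbb{K},f,u)$ is a proper subset of $G$. Then $\mathbb{G}$ is S\l upecki.
   Context: All digraphs are finite and reflexive. For a digraph $\mathbb{K}$, vertices $x_1,\dots,x_k,u$ of $\mathbb{K}$ and a map $f:\{x_1,\dots,x_k\}\to G$, the set pp-defined by $(\mathbb{K},f,u)$ is $\{g(u) : g:\mathbb{K}\to\mathbb{G} \text{ a homomorphism with } g(x_i)=f(x_i) \text{ for all } i\}$. A $k$-ary polymorphism is a homomorphism $\mathbb{G}^k\to\mathbb{G}$ from the product digraph; it is essentially unary if it equals $(y_1,\dots,y_k)\mapsto h(y_i)$ for some $i$ and homomorphism $h:\mathbb{G}\to\mathbb{G}$. $\mathbb{G}$ is S\l upecki if for every $k\geq 2$ every surjective $k$-ary polymorphism is essentially unary.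
   Formalization: The formal theorem assumes in addition that G does not have exactly two vertices; for |G| = 2 the statement fails, since with K a single vertex x_1 = u both (1) and (2) hold, while no two-vertex reflexive digraph is Słupecki. *)

theory Defs
  imports "Graph_Theory.Pair_Digraph" "HOL-Library.FuncSet"
begin

locale reflexive_digraph = pair_fin_digraph G for G :: "'a pair_pre_digraph" +
  assumes reflexive: "refl_on (pverts G) (parcs G)"

definition dg_hom :: "'a pair_pre_digraph \<Rightarrow> 'b pair_pre_digraph \<Rightarrow> ('a \<Rightarrow> 'b) \<Rightarrow> bool" where
  "dg_hom H G g \<longleftrightarrow>
     g \<in> pverts H \<rightarrow> pverts G \<and> (\<forall>(x, y) \<in> parcs H. (g x, g y) \<in> parcs G)"

text \<open>Only the values of \<open>f\<close> on \<open>set xs\<close> matter: it stands for a map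
  \<open>{x\<^sub>1, \<dots>, x\<^sub>k} \<rightarrow> G\<close>.\<close>

definition pp_defined ::
    "'a pair_pre_digraph \<Rightarrow> 'b pair_pre_digraph \<Rightarrow> 'b list \<Rightarrow> ('b \<Rightarrow> 'a) \<Rightarrow> 'b \<Rightarrow> 'a set" where
  "pp_defined G K xs f u = {g u | g. dg_hom K G g \<and> (\<forall>x \<in> set xs. g x = f x)}"

text \<open>Elements of \<open>G\<^sup>k\<close> are functions on \<open>{..<k}\<close>, extensional so that
  each tuple has exactly one representative.\<close>

definition dg_power :: "'a pair_pre_digraph \<Rightarrow> nat \<Rightarrow> (nat \<Rightarrow> 'a) pair_pre_digraph" where
  "dg_power G k =
     \<lparr> pverts = {..<k} \<rightarrow>\<^sub>E pverts G,
       parcs = {(y, z). y \<in> {..<k} \<rightarrow>\<^sub>E pverts G \<and> z \<in> {..<k} \<rightarrow>\<^sub>E pverts G \<and>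
                        (\<forall>i<k. (y i, z i) \<in> parcs G)} \<rparr>"

definition polymorphism :: "'a pair_pre_digraph \<Rightarrow> nat \<Rightarrow> ((nat \<Rightarrow> 'a) \<Rightarrow> 'a) \<Rightarrow> bool" where
  "polymorphism G k F \<longleftrightarrow> dg_hom (dg_power G k) G F"

definition essentially_unary ::
    "'a pair_pre_digraph \<Rightarrow> nat \<Rightarrow> ((nat \<Rightarrow> 'a) \<Rightarrow> 'a) \<Rightarrow> bool" where
  "essentially_unary G k F \<longleftrightarrow>
     (\<exists>i<k. \<exists>h. dg_hom G G h \<and> (\<forall>y \<in> pverts (dg_power G k). F y = h (y i)))"

definition slupecki :: "'a pair_pre_digraph \<Rightarrow> bool" where
  "slupecki G \<longleftrightarrow>
     (\<forall>k\<ge>2. \<forall>F. polymorphism G k F \<and> F ` pverts (dg_power G k) = pverts G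
        \<longrightarrow> essentially_unary G k F)"

text \<open>Two-element digraphs have to be excluded from the theorem. Taking for \<open>K\<close> a single vertex
  \<open>x\<^sub>1 = u\<close>, the pp-defined sets are exactly the singletons, so both hypotheses hold for every
  digraph with two vertices, whereas the complete one admits conjunction as a polymorphism.\<close>

lemma two_element_counterexample:
  defines "G \<equiv> \<lparr> pverts = (UNIV :: bool set), parcs = UNIV \<rparr>"
    and "K \<equiv> \<lparr> pverts = (UNIV :: unit set), parcs = UNIV \<rparr>"
  shows "reflexive_digraph G" "reflexive_digraph K"
    and "\<forall>a \<in> pverts G. \<exists>f \<in> set [()] \<rightarrow> pverts G. pp_defined G K [()] f () = pverts G - {a}"
    and "\<forall>f \<in> set [()] \<rightarrow> pverts G. pp_defined G K [()] f () \<subset> pverts G"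
    and "\<not> slupecki G"
proof -
  show "reflexive_digraph G" "reflexive_digraph K"
    by (unfold_locales; simp add: G_def K_def refl_on_def)+
  have V: "pverts G = UNIV"
    by (simp add: G_def)
  have pp: "pp_defined G K [()] f () = {f ()}" for f
    by (auto simp: pp_defined_def dg_hom_def G_def K_def)
  show "\<forall>a \<in> pverts G. \<exists>f \<in> set [()] \<rightarrow> pverts G. pp_defined G K [()] f () = pverts G - {a}"
  proof
    fix a
    show "\<exists>f \<in> set [()] \<rightarrow> pverts G. pp_defined G K [()] f () = pverts G - {a}"
      by (rule bexI[of _ "\<lambda>_. \<not> a"]) (auto simp: pp V)
  qed
  show "\<forall>f \<in> set [()] \<rightarrow> pverts G. pp_defined G K [()] f () \<subset> pverts G"
    by (auto simp: pp V UNIV_bool)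
  show "\<not> slupecki G"
  proof
    assume sl: "slupecki G"
    define F where "F = (\<lambda>y :: nat \<Rightarrow> bool. y 0 \<and> y 1)"
    define t where "t = (\<lambda>a b. \<lambda>i\<in>{..<2::nat}. if i = 0 then a else b :: bool)"
    have t: "t a b \<in> pverts (dg_power G 2)" "F (t a b) = (a \<and> b)" "t a b 0 = a" "t a b 1 = b" for a b
      by (auto simp: t_def dg_power_def G_def F_def)
    have "polymorphism G 2 F"
      by (auto simp: polymorphism_def dg_hom_def G_def)
    moreover have "F ` pverts (dg_power G 2) = pverts G"
    proof -
      have "c \<in> F ` pverts (dg_power G 2)" for c
        by (rule image_eqI[OF _ t(1)[of c c]]) (simp add: t(2))
      then show ?thesis by (auto simp: V)
    qed
    ultimately have "essentially_unary G 2 F"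
      using sl by (simp add: slupecki_def)
    then obtain i h where "i < 2" and h: "\<And>y. y \<in> pverts (dg_power G 2) \<Longrightarrow> F y = h (y i)"
      by (auto simp: essentially_unary_def)
    then have "i = 0 \<or> i = 1" by auto
    then show False
      using h[OF t(1)[of True True]] h[OF t(1)[of True False]] h[OF t(1)[of False True]]
      by (auto simp: t simp del: One_nat_def)
  qed
qed

end

theory Submission
  imports Defs
begin

text \<open>
  Applying a polymorphism \<open>F\<close> to \<open>k\<close> homomorphisms \<open>K \<rightarrow> G\<close> shows that \<open>F\<close> maps the product of the
  sets pp-defined by \<open>f\<^sub>1, \<dots>, f\<^sub>k\<close> into the set pp-defined by \<open>F(f\<^sub>1, \<dots>, f\<^sub>k)\<close>. By the two
  hypotheses, \<open>F\<close> is therefore not onto on any box \<open>\<Prod>\<^sub>i (G - {a\<^sub>i})\<close>. On the other hand, by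
  Yablonskii's lemma, a surjective operation on a finite set with at least three elements that
  depends on two of its arguments is already onto on such a box. Indeed, two points of a line on
  which the operation is not constant, together with a tuple that agrees with one of them in the
  direction of the line, can be chosen to have distinct values, and these three tuples use at most
  two elements in every coordinate; a preimage for each of the remaining \<open>n - 3\<close> values adds at
  most \<open>n - 3\<close> elements to every coordinate.
\<close>

lemma ex_not_mem_if_card_less:
  assumes "finite B" and "card B < card A"
  shows "\<exists>c\<in>A. c \<notin> B"
  using assms card_mono[of B A] by fastforce

lemma image_transversal_extension:
  assumes fin: "finite (F ` X)" and "S \<subseteq> X"
  obtains R where "R \<subseteq> X" and "finite R" and "card R = card (F ` X) - card (F ` S)"
    and "F ` (S \<union> R) = F ` X"
proof -
  obtain R where R: "R \<subseteq> X" "inj_on F R" "F ` R = F ` X - F ` S"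
    using subset_image_inj[of "F ` X - F ` S" F X] by auto
  have "F ` S \<subseteq> F ` X"
    using \<open>S \<subseteq> X\<close> by (rule image_mono)
  show thesis
  proof (rule that)
    show "finite R"
      using finite_imageD[OF _ R(2)] fin R(3) by simp
    have "card R = card (F ` X - F ` S)"
      using card_image[OF R(2)] R(3) by simp
    also have "\<dots> = card (F ` X) - card (F ` S)"
      using \<open>F ` S \<subseteq> F ` X\<close> fin by (intro card_Diff_subset) (rule finite_subset)
    finally show "card R = card (F ` X) - card (F ` S)" .
    show "F ` (S \<union> R) = F ` X"
      using R(3) \<open>F ` S \<subseteq> F ` X\<close> by blast
  qed (rule R(1))
qed

lemma fun_upd_mem_PiE:
  assumes "y \<in> Pi\<^sub>E I A" and "i \<in> I" and "b \<in> A i"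
  shows "y(i := b) \<in> Pi\<^sub>E I A"
  using PiE_fun_upd[of b A i y I] assms by (simp add: insert_absorb)

definition factors_through_coordinate ::
    "'i set \<Rightarrow> ('i \<Rightarrow> 'a set) \<Rightarrow> (('i \<Rightarrow> 'a) \<Rightarrow> 'b) \<Rightarrow> 'i \<Rightarrow> bool" where
  "factors_through_coordinate I A F i \<longleftrightarrow> (\<exists>h. \<forall>y \<in> Pi\<^sub>E I A. F y = h (y i))"

lemma nonconstant_changes_along_coordinate:
  assumes "finite I" and y: "y \<in> Pi\<^sub>E I A" and z: "z \<in> Pi\<^sub>E I A" and "F y \<noteq> F z"
  obtains w i b where "w \<in> Pi\<^sub>E I A" and "i \<in> I" and "b \<in> A i" and "F (w(i := b)) \<noteq> F w"
proof (rule ccontr)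
  assume "\<not> thesis"
  with that have unchanged: "F (w(i := b)) = F w"
    if "w \<in> Pi\<^sub>E I A" "i \<in> I" "b \<in> A i" for w i b
    using \<open>w \<in> Pi\<^sub>E I A\<close> \<open>i \<in> I\<close> \<open>b \<in> A i\<close> by blast
  have "F (override_on y z J) = F y" if "finite J" "J \<subseteq> I" for J
    using that
  proof (induction J rule: finite_induct)
    case (insert j J)
    have "override_on y z J \<in> Pi\<^sub>E I A"
      using y z insert.prems by (auto simp: override_on_def PiE_iff extensional_def)
    moreover have "j \<in> I" and "z j \<in> A j"
      using z insert.prems by auto
    ultimately show ?case
      using unchanged[of "override_on y z J" j "z j"] insert by (simp only: override_on_insert) simp
  qed simp
  moreover have "override_on y z I = z"
    using y z by (auto simp: override_on_def PiE_iff extensional_def)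
  ultimately show False
    using \<open>finite I\<close> \<open>F y \<noteq> F z\<close> by (metis order_refl)
qed

lemma three_values_on_line_and_point:
  fixes F :: "('i \<Rightarrow> 'a) \<Rightarrow> 'b"
  assumes three: "3 \<le> card (F ` Pi\<^sub>E I A)"
    and not_unary: "\<not> factors_through_coordinate I A F i"
    and "i \<in> I" and y: "y \<in> Pi\<^sub>E I A" and "b \<in> A i" and change: "F (y(i := b)) \<noteq> F y"
  obtains z c where "z \<in> Pi\<^sub>E I A" and "c \<in> A i"
    and "F (y(i := z i)) \<noteq> F (y(i := c))" and "F z \<notin> {F (y(i := z i)), F (y(i := c))}"
proof (cases "\<exists>z \<in> Pi\<^sub>E I A. F z \<notin> (\<lambda>c. F (y(i := c))) ` A i")
  case True
  then obtain z where z: "z \<in> Pi\<^sub>E I A" and missed: "F z \<notin> (\<lambda>c. F (y(i := c))) ` A i"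
    by blast
  have "z i \<in> A i" and "y i \<in> A i"
    using y z \<open>i \<in> I\<close> by (simp_all add: PiE_mem)
  have "\<exists>c \<in> A i. F (y(i := z i)) \<noteq> F (y(i := c))"
    using change \<open>b \<in> A i\<close> \<open>y i \<in> A i\<close> by (metis fun_upd_triv)
  then show thesis
    using z missed \<open>z i \<in> A i\<close> that by blast
next
  case False
  have "\<not> (\<forall>z \<in> Pi\<^sub>E I A. F z = F (y(i := z i)))"
    using not_unary exI[of _ "\<lambda>c. F (y(i := c))"] unfolding factors_through_coordinate_def by fast
  then obtain z where z: "z \<in> Pi\<^sub>E I A" and off_line: "F z \<noteq> F (y(i := z i))"
    by blast
  have "card {F z, F (y(i := z i))} < card (F ` Pi\<^sub>E I A)"
    using three card_insert_le_m1[of 2 "{F (y(i := z i))}" "F z"] by simp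
  then obtain v where "v \<in> F ` Pi\<^sub>E I A" and v: "v \<noteq> F z" "v \<noteq> F (y(i := z i))"
    using ex_not_mem_if_card_less[of "{F z, F (y(i := z i))}"] by blast
  then obtain c where "c \<in> A i" and "v = F (y(i := c))"
    using False by blast
  then show thesis
    using z off_line v that by auto
qed

lemma three_values_two_per_coordinate:
  fixes F :: "('i \<Rightarrow> 'a) \<Rightarrow> 'b"
  assumes "finite I" and three: "3 \<le> card (F ` Pi\<^sub>E I A)"
    and not_unary: "\<And>i. i \<in> I \<Longrightarrow> \<not> factors_through_coordinate I A F i"
  obtains S where "S \<subseteq> Pi\<^sub>E I A" and "finite S" and "card (F ` S) = 3"
    and "\<forall>j. card ((\<lambda>y. y j) ` S) \<le> 2"
proof -
  have "finite (F ` Pi\<^sub>E I A)"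
    using three by (auto intro: card_ge_0_finite)
  then obtain p q where "p \<in> Pi\<^sub>E I A" "q \<in> Pi\<^sub>E I A" "F p \<noteq> F q"
    using card_le_Suc0_iff_eq[of "F ` Pi\<^sub>E I A"] three by auto
  then obtain y i b where y: "y \<in> Pi\<^sub>E I A" and i: "i \<in> I"
      and b: "b \<in> A i" "F (y(i := b)) \<noteq> F y"
    by (rule nonconstant_changes_along_coordinate[OF \<open>finite I\<close>])
  obtain z c where z: "z \<in> Pi\<^sub>E I A" and c: "c \<in> A i"
    and distinct: "F (y(i := z i)) \<noteq> F (y(i := c))" "F z \<notin> {F (y(i := z i)), F (y(i := c))}"
    using three_values_on_line_and_point[OF three not_unary[OF i] i y b] .
  show thesis
  proof (rule that)
    show "{y(i := z i), y(i := c), z} \<subseteq> Pi\<^sub>E I A"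
      using y z c i by (simp add: fun_upd_mem_PiE PiE_mem)
    show "card (F ` {y(i := z i), y(i := c), z}) = 3"
      using distinct by auto
    show "\<forall>j. card ((\<lambda>y. y j) ` {y(i := z i), y(i := c), z}) \<le> 2"
      by (simp add: card_insert_if)
  qed simp
qed

lemma yablonskii:
  fixes F :: "('i \<Rightarrow> 'a) \<Rightarrow> 'b"
  assumes "finite I" and three: "3 \<le> card (F ` Pi\<^sub>E I A)"
    and "\<And>i. i \<in> I \<Longrightarrow> \<not> factors_through_coordinate I A F i"
  obtains B where "\<forall>i\<in>I. B i \<subseteq> A i \<and> finite (B i) \<and> card (B i) < card (F ` Pi\<^sub>E I A)"
    and "F ` Pi\<^sub>E I B = F ` Pi\<^sub>E I A"
proof -
  obtain S where S: "S \<subseteq> Pi\<^sub>E I A" "finite S" "card (F ` S) = 3"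
      and card_S: "\<forall>j. card ((\<lambda>y. y j) ` S) \<le> 2"
    by (rule three_values_two_per_coordinate[OF assms])
  have "finite (F ` Pi\<^sub>E I A)"
    using three by (auto intro: card_ge_0_finite)
  then obtain R where R: "R \<subseteq> Pi\<^sub>E I A" "finite R"
      and card_R: "card R = card (F ` Pi\<^sub>E I A) - card (F ` S)"
      and onto: "F ` (S \<union> R) = F ` Pi\<^sub>E I A"
    using S(1) by (rule image_transversal_extension)
  define B where "B = (\<lambda>j. (\<lambda>y. y j) ` (S \<union> R))"
  have B: "B i \<subseteq> A i \<and> finite (B i) \<and> card (B i) < card (F ` Pi\<^sub>E I A)" if "i \<in> I" for i
  proof (intro conjI)
    show "B i \<subseteq> A i"
      using S(1) R(1) that by (auto simp: B_def)
    show "finite (B i)"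
      using S(2) R(2) by (simp add: B_def)
    have "card (B i) \<le> card ((\<lambda>y. y i) ` S) + card ((\<lambda>y. y i) ` R)"
      unfolding B_def image_Un by (rule card_Un_le)
    also have "\<dots> \<le> 2 + (card (F ` Pi\<^sub>E I A) - 3)"
      using add_mono[OF spec[OF card_S] card_image_le[OF R(2)]] unfolding card_R S(3) .
    finally show "card (B i) < card (F ` Pi\<^sub>E I A)"
      using three by simp
  qed
  have "S \<union> R \<subseteq> Pi\<^sub>E I B"
    using S(1) R(1) by (auto simp: B_def PiE_iff)
  then have "F ` Pi\<^sub>E I A \<subseteq> F ` Pi\<^sub>E I B"
    unfolding onto[symmetric] by (rule image_mono)
  moreover have "F ` Pi\<^sub>E I B \<subseteq> F ` Pi\<^sub>E I A"
    using B by (intro image_mono PiE_mono) simp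
  ultimately show thesis
    using B by (intro that[of B]) auto
qed

corollary yablonskii_omitting_one_per_coordinate:
  fixes F :: "('i \<Rightarrow> 'a) \<Rightarrow> 'b"
  assumes "finite I" and "3 \<le> card (F ` Pi\<^sub>E I A)"
    and "\<And>i. i \<in> I \<Longrightarrow> \<not> factors_through_coordinate I A F i"
    and card_le: "\<And>i. i \<in> I \<Longrightarrow> card (F ` Pi\<^sub>E I A) \<le> card (A i)"
  obtains a where "a \<in> Pi I A" and "F ` (\<Pi>\<^sub>E i\<in>I. A i - {a i}) = F ` Pi\<^sub>E I A"
proof -
  obtain B where B: "\<forall>i\<in>I. B i \<subseteq> A i \<and> finite (B i) \<and> card (B i) < card (F ` Pi\<^sub>E I A)"
    and onto: "F ` Pi\<^sub>E I B = F ` Pi\<^sub>E I A"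
    by (rule yablonskii[OF assms(1-3)])
  have "\<exists>b. b \<in> A i \<and> b \<notin> B i" if "i \<in> I" for i
    using ex_not_mem_if_card_less[of "B i" "A i"] B card_le[OF that] that by force
  then obtain a where a: "\<And>i. i \<in> I \<Longrightarrow> a i \<in> A i" "\<And>i. i \<in> I \<Longrightarrow> a i \<notin> B i"
    by metis
  have "Pi\<^sub>E I B \<subseteq> (\<Pi>\<^sub>E i\<in>I. A i - {a i})"
    using a(2) B by (intro PiE_mono) blast
  then have "F ` Pi\<^sub>E I A \<subseteq> F ` (\<Pi>\<^sub>E i\<in>I. A i - {a i})"
    unfolding onto[symmetric] by (rule image_mono)
  moreover have "F ` (\<Pi>\<^sub>E i\<in>I. A i - {a i}) \<subseteq> F ` Pi\<^sub>E I A"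
    by (intro image_mono PiE_mono Diff_subset)
  moreover have "a \<in> Pi I A"
    using a(1) by (rule Pi_I)
  ultimately show thesis
    by (intro that) auto
qed

lemma pverts_dg_power [simp]: "pverts (dg_power G k) = {..<k} \<rightarrow>\<^sub>E pverts G"
  by (simp add: dg_power_def)

lemma dg_hom_ident: "dg_hom G G (\<lambda>a. a)"
  by (auto simp: dg_hom_def)

lemma dg_hom_compose:
  assumes "dg_hom K H g" and "dg_hom H G h"
  shows "dg_hom K G (\<lambda>x. h (g x))"
  using assms unfolding dg_hom_def by fast

lemma dg_hom_tuple:
  assumes "pair_wf_digraph K" and g: "\<And>i. i < k \<Longrightarrow> dg_hom K G (g i)"
  shows "dg_hom K (dg_power G k) (\<lambda>x. \<lambda>i\<in>{..<k}. g i x)"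
proof -
  interpret K: pair_wf_digraph K by fact
  have "g i x \<in> pverts G" if "i < k" "x \<in> pverts K" for i x
    using g that by (auto simp: dg_hom_def)
  moreover have "(g i x, g i y) \<in> parcs G" if "i < k" "(x, y) \<in> parcs K" for i x y
    using g[OF that(1)] that(2) by (auto simp: dg_hom_def)
  ultimately show ?thesis
    by (auto simp: dg_hom_def dg_power_def dest: K.wellformed')
qed

lemma dg_hom_power_image_pp_defined:
  assumes F: "dg_hom (dg_power G k) H F" and K: "pair_wf_digraph K"
  shows "F ` (\<Pi>\<^sub>E i\<in>{..<k}. pp_defined G K xs (f i) u)
    \<subseteq> pp_defined H K xs (\<lambda>x. F (\<lambda>i\<in>{..<k}. f i x)) u"
proof (rule image_subsetI)
  fix y assume y: "y \<in> (\<Pi>\<^sub>E i\<in>{..<k}. pp_defined G K xs (f i) u)"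
  then have "\<exists>g. y i = g u \<and> dg_hom K G g \<and> (\<forall>x\<in>set xs. g x = f i x)" if "i < k" for i
    using that by (auto simp: pp_defined_def PiE_iff)
  then obtain g where g: "\<And>i. i < k \<Longrightarrow> y i = g i u" "\<And>i. i < k \<Longrightarrow> dg_hom K G (g i)"
      "\<And>i x. i < k \<Longrightarrow> x \<in> set xs \<Longrightarrow> g i x = f i x"
    by metis
  let ?g = "\<lambda>x. F (\<lambda>i\<in>{..<k}. g i x)"
  have "dg_hom K H ?g"
    using dg_hom_tuple[OF K g(2)] F by (rule dg_hom_compose)
  moreover have "?g x = F (\<lambda>i\<in>{..<k}. f i x)" if "x \<in> set xs" for x
    using g(3) that by (intro arg_cong[where f = F] restrict_ext) simp
  moreover have "y = (\<lambda>i\<in>{..<k}. g i u)"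
    using y g(1) by (intro extensionalityI[of _ "{..<k}"]) (auto simp: PiE_iff)
  ultimately show "F y \<in> pp_defined H K xs (\<lambda>x. F (\<lambda>i\<in>{..<k}. f i x)) u"
    unfolding pp_defined_def by (intro CollectI exI[of _ ?g]) simp
qed

lemma polymorphism_mem_pverts:
  assumes "polymorphism G k F" and "y \<in> {..<k} \<rightarrow>\<^sub>E pverts G"
  shows "F y \<in> pverts G"
  using assms by (auto simp: polymorphism_def dg_hom_def)

lemma polymorphism_not_onto_on_proper_box:
  assumes F: "polymorphism G k F" and K: "pair_wf_digraph K"
    and complements: "\<And>b. b \<in> pverts G \<Longrightarrow>
      \<exists>f \<in> set xs \<rightarrow> pverts G. pp_defined G K xs f u = pverts G - {b}"
    and proper: "\<And>f. f \<in> set xs \<rightarrow> pverts G \<Longrightarrow> pp_defined G K xs f u \<subset> pverts G"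
    and a: "a \<in> {..<k} \<rightarrow> pverts G"
  shows "F ` (\<Pi>\<^sub>E i\<in>{..<k}. pverts G - {a i}) \<subset> pverts G"
proof -
  have "\<exists>f. f \<in> set xs \<rightarrow> pverts G \<and> pp_defined G K xs f u = pverts G - {a i}"
    if "i \<in> {..<k}" for i
    using complements[of "a i"] a that by blast
  then obtain f where f: "\<And>i. i \<in> {..<k} \<Longrightarrow> f i \<in> set xs \<rightarrow> pverts G"
      "\<And>i. i \<in> {..<k} \<Longrightarrow> pp_defined G K xs (f i) u = pverts G - {a i}"
    by metis
  let ?f = "\<lambda>x. F (\<lambda>i\<in>{..<k}. f i x)"
  have "(\<Pi>\<^sub>E i\<in>{..<k}. pp_defined G K xs (f i) u) = (\<Pi>\<^sub>E i\<in>{..<k}. pverts G - {a i})"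
    using f(2) by (rule PiE_cong)
  then have "F ` (\<Pi>\<^sub>E i\<in>{..<k}. pverts G - {a i}) \<subseteq> pp_defined G K xs ?f u"
    using dg_hom_power_image_pp_defined[of G k G F K xs f u] F K by (simp add: polymorphism_def)
  also have "\<dots> \<subset> pverts G"
  proof (rule proper)
    have "(\<lambda>i\<in>{..<k}. f i x) \<in> {..<k} \<rightarrow>\<^sub>E pverts G" if "x \<in> set xs" for x
      using f(1) that by auto
    then show "?f \<in> set xs \<rightarrow> pverts G"
      using polymorphism_mem_pverts[OF F] by blast
  qed
  finally show ?thesis .
qed

lemma essentially_unary_if_factors_through_coordinate:
  assumes G: "pair_wf_digraph G" and F: "polymorphism G k F" and "i < k"
    and "factors_through_coordinate {..<k} (\<lambda>_. pverts G) F i"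
  shows "essentially_unary G k F"
proof -
  let ?diag = "\<lambda>a. F (\<lambda>j\<in>{..<k}. a)"
  obtain h where h: "\<And>y. y \<in> {..<k} \<rightarrow>\<^sub>E pverts G \<Longrightarrow> F y = h (y i)"
    using assms(4) by (auto simp: factors_through_coordinate_def)
  have "dg_hom G G ?diag"
    using dg_hom_compose[OF dg_hom_tuple[OF G dg_hom_ident]] F by (simp add: polymorphism_def)
  moreover have "F y = ?diag (y i)" if "y \<in> {..<k} \<rightarrow>\<^sub>E pverts G" for y
  proof -
    have "(\<lambda>j\<in>{..<k}. y i) \<in> {..<k} \<rightarrow>\<^sub>E pverts G"
      using that \<open>i < k\<close> by auto
    then show ?thesis
      using h[OF that] h[of "\<lambda>j\<in>{..<k}. y i"] \<open>i < k\<close> by simp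
  qed
  ultimately show ?thesis
    using \<open>i < k\<close> unfolding essentially_unary_def pverts_dg_power by blast
qed

lemma slupecki_if_at_most_one_vertex:
  assumes "\<forall>a \<in> pverts G. \<forall>b \<in> pverts G. a = b"
  shows "slupecki G"
  unfolding slupecki_def
proof (intro allI impI, elim conjE)
  fix k :: nat and F
  assume "2 \<le> k" and F: "polymorphism G k F"
  then have "0 < k"
    by simp
  have "F y = y 0" if y: "y \<in> {..<k} \<rightarrow>\<^sub>E pverts G" for y
  proof -
    have "y 0 \<in> pverts G"
      using y \<open>0 < k\<close> by (simp add: PiE_iff)
    with assms polymorphism_mem_pverts[OF F y] show ?thesis
      by blast
  qed
  then show "essentially_unary G k F"
    unfolding essentially_unary_def pverts_dg_power using \<open>0 < k\<close> dg_hom_ident by fast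
qed

lemma slupecki_if_not_onto_on_proper_boxes:
  assumes G: "pair_wf_digraph G" and three: "3 \<le> card (pverts G)"
    and not_onto: "\<And>k F a. polymorphism G k F \<Longrightarrow> a \<in> {..<k} \<rightarrow> pverts G \<Longrightarrow>
      F ` (\<Pi>\<^sub>E i\<in>{..<k}. pverts G - {a i}) \<subset> pverts G"
  shows "slupecki G"
  unfolding slupecki_def
proof (intro allI impI, elim conjE, rule ccontr)
  fix k F
  assume F: "polymorphism G k F" and "F ` pverts (dg_power G k) = pverts G"
    and "\<not> essentially_unary G k F"
  then have onto: "F ` ({..<k} \<rightarrow>\<^sub>E pverts G) = pverts G"
    by simp
  have not_unary: "\<not> factors_through_coordinate {..<k} (\<lambda>_. pverts G) F i" if "i \<in> {..<k}" for i
    using essentially_unary_if_factors_through_coordinate[OF G F] that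
      \<open>\<not> essentially_unary G k F\<close> by blast
  obtain a where a: "a \<in> {..<k} \<rightarrow> pverts G"
    and onto_box: "F ` (\<Pi>\<^sub>E i\<in>{..<k}. pverts G - {a i}) = F ` ({..<k} \<rightarrow>\<^sub>E pverts G)"
    using yablonskii_omitting_one_per_coordinate[of "{..<k}" F "\<lambda>_. pverts G"]
      three onto not_unary by auto
  show False
    using not_onto[OF F a] unfolding onto_box onto by simp
qed

theorem theorem4p4:
  fixes G :: "'a pair_pre_digraph" and K :: "'b pair_pre_digraph"
    and xs :: "'b list" and u :: 'b
  assumes "reflexive_digraph G" and "card (pverts G) \<noteq> 2"
    and "reflexive_digraph K" and "set xs \<subseteq> pverts K" and "u \<in> pverts K"
    and "\<forall>a \<in> pverts G. \<exists>f \<in> set xs \<rightarrow> pverts G. pp_defined G K xs f u = pverts G - {a}"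
    and "\<forall>f \<in> set xs \<rightarrow> pverts G. pp_defined G K xs f u \<subset> pverts G"
  shows "slupecki G"
proof -
  interpret G: reflexive_digraph G by fact
  interpret K: reflexive_digraph K by fact
  consider (at_most_one) "card (pverts G) \<le> Suc 0" | (at_least_three) "3 \<le> card (pverts G)"
    using assms(2) by linarith
  then show ?thesis
  proof cases
    case at_most_one
    then have "\<forall>a \<in> pverts G. \<forall>b \<in> pverts G. a = b"
      using card_le_Suc0_iff_eq[OF G.pair_finite_verts] by simp
    then show ?thesis
      by (rule slupecki_if_at_most_one_vertex)
  next
    case at_least_three
    have "F ` (\<Pi>\<^sub>E i\<in>{..<k}. pverts G - {a i}) \<subset> pverts G"
      if F: "polymorphism G k F" and a: "a \<in> {..<k} \<rightarrow> pverts G" for k F a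
      using F K.pair_wf_digraph_axioms bspec[OF assms(6)] bspec[OF assms(7)] a
      by (rule polymorphism_not_onto_on_proper_box)
    then show ?thesis
      by (rule slupecki_if_not_onto_on_proper_boxes[OF G.pair_wf_digraph_axioms at_least_three])
  qed
qed

end
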